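(* Let $M$ be a monoid, let $A$ be a finite set, and let $X\subset A^M$ be a subshift of finite type. Then the dynamical system $(X,M)$ is topologically stable.
   Context: $A^M$ is the set of all maps $M\to A$ with the prodiscrete topology (product topology with each factor $A$ discrete), which is compact Hausdorff. $M$ acts continuously on $A^M$ by the shift $(m x)(m')=x(m'm)$ for $m,m'\in M$, $x\in A^M$; this is a monoid action ($1_Mx=x$). A subshift is a closed $M$-invariant subset $X\subset A^M$; $(X,M)$ denotes $X$ with the restricted shift action. A subshift $X$ is of finite type if there exist a finite subset $W\subset M$ and $P\subset A^W$ such that $X=\{x\in A^M : (mx)|_W\in P \text{ for all } m\in M\}$. A compact Hausdorff space $X$ carries a unique uniform structure inducing its topology; its entourages are the neighborhoods of the diagonal in $X\times X$. Topological stability: a continuous monoid action of $M$ on $X$ is a family of continuous maps $\alpha_m\colon X\to X$ ($m\in M$) with $\alpha_m\circ\alpha_{m'}=\alpha_{mm'}$ and $\alpha_{1_M}=\mathrm{Id}_X$. Let $\mathrm{CMA}_M(X)$ be the set of all continuous monoid actions of $M$ on $X$, with the topology of the uniform structure having as a base of entourages the sets $\{(\alpha,\beta): (\alpha_k(x),\beta_k(x))\in U \text{ for all } k\in K, x\in X\}$, where $K$ runs over finite subsets of $M$ and $U$ over entourages of $X$. For $\alpha\in\mathrm{CMA}_M(X)$, $(X,M,\alpha)$ is topologically stable if for every entourage $U$ of $X$ there is a neighborhood $N$ of $\alpha$ in $\mathrm{CMA}_M(X)$ such that for every $\beta\in N$ there is a continuous map $h\colon X\to X$ with $\alpha_m\circ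 h=h\circ\beta_m$ for all $m\in M$ and $(h(x),x)\in U$ for all $x\in X$. *)

theory Defs
  imports "HOL-Analysis.Analysis" "HOL-Algebra.Group"
begin

definition neighborhoods :: "'x topology \<Rightarrow> 'x set \<Rightarrow> 'x set set" where
  "neighborhoods T S = {N. N \<subseteq> topspace T \<and> (\<exists>V. openin T V \<and> S \<subseteq> V \<and> V \<subseteq> N)}"

text \<open>The unique uniform structure of a compact Hausdorff space; this is not a uniform structure
  for arbitrary \<open>T\<close>.\<close>

definition entourages :: "'x topology \<Rightarrow> ('x \<times> 'x) set set" where
  "entourages T = neighborhoods (prod_topology T T) (Id_on (topspace T))"

lemma entourages_Int:
  assumes "U \<in> entourages T" "V \<in> entourages T"
  shows "U \<inter> V \<in> entourages T"
proof -
  obtain U' V' where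
    "openin (prod_topology T T) U'" "Id_on (topspace T) \<subseteq> U'" "U' \<subseteq> U"
    "openin (prod_topology T T) V'" "Id_on (topspace T) \<subseteq> V'" "V' \<subseteq> V"
    using assms unfolding entourages_def neighborhoods_def by blast
  then have "openin (prod_topology T T) (U' \<inter> V')" "Id_on (topspace T) \<subseteq> U' \<inter> V'"
    "U' \<inter> V' \<subseteq> U \<inter> V"
    by auto
  then show ?thesis
    using assms unfolding entourages_def neighborhoods_def by blast
qed

lemma topspace_entourage: "topspace T \<times> topspace T \<in> entourages T"
proof -
  have "openin (prod_topology T T) (topspace T \<times> topspace T)"
    by (metis openin_topspace topspace_prod_topology)
  then show ?thesis
    unfolding entourages_def neighborhoods_def by auto
qed

text \<open>Families of maps are taken extensional in both arguments, so that elements of \<open>CMA M T\<close>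
  correspond bijectively to the continuous monoid actions of \<open>M\<close> on \<open>T\<close>.\<close>

definition CMA :: "('m, 'r) monoid_scheme \<Rightarrow> 'x topology \<Rightarrow> ('m \<Rightarrow> 'x \<Rightarrow> 'x) set" where
  "CMA M T = {\<alpha> \<in> carrier M \<rightarrow>\<^sub>E (topspace T \<rightarrow>\<^sub>E topspace T).
     (\<forall>m\<in>carrier M. continuous_map T T (\<alpha> m)) \<and>
     (\<forall>m\<in>carrier M. \<forall>m'\<in>carrier M. \<forall>x\<in>topspace T. \<alpha> m (\<alpha> m' x) = \<alpha> (m \<otimes>\<^bsub>M\<^esub> m') x) \<and>
     (\<forall>x\<in>topspace T. \<alpha> \<one>\<^bsub>M\<^esub> x = x)}"

definition CMA_entourage ::
    "('m, 'r) monoid_scheme \<Rightarrow> 'x topology \<Rightarrow> 'm set \<Rightarrow> ('x \<times> 'x) set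
      \<Rightarrow> (('m \<Rightarrow> 'x \<Rightarrow> 'x) \<times> ('m \<Rightarrow> 'x \<Rightarrow> 'x)) set" where
  "CMA_entourage M T K U =
     {(\<alpha>, \<beta>). \<alpha> \<in> CMA M T \<and> \<beta> \<in> CMA M T \<and> (\<forall>k\<in>K. \<forall>x\<in>topspace T. (\<alpha> k x, \<beta> k x) \<in> U)}"

definition CMA_topology :: "('m, 'r) monoid_scheme \<Rightarrow> 'x topology \<Rightarrow> ('m \<Rightarrow> 'x \<Rightarrow> 'x) topology" where
  "CMA_topology M T = topology (\<lambda>S. S \<subseteq> CMA M T \<and>
     (\<forall>\<alpha>\<in>S. \<exists>K U. finite K \<and> K \<subseteq> carrier M \<and> U \<in> entourages T \<and>
        CMA_entourage M T K U `` {\<alpha>} \<subseteq> S))"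

lemma openin_CMA_topology:
  fixes M :: "('m, 'r) monoid_scheme" and T :: "'x topology"
  shows "openin (CMA_topology M T) S \<longleftrightarrow> S \<subseteq> CMA M T \<and>
     (\<forall>\<alpha>\<in>S. \<exists>K U. finite K \<and> K \<subseteq> carrier M \<and> U \<in> entourages T \<and>
        CMA_entourage M T K U `` {\<alpha>} \<subseteq> S)"
proof -
  let ?good = "\<lambda>(S :: ('m \<Rightarrow> 'x \<Rightarrow> 'x) set) \<alpha>. \<exists>K U. finite K \<and> K \<subseteq> carrier M \<and> U \<in> entourages T \<and>
        CMA_entourage M T K U `` {\<alpha>} \<subseteq> S"
  have int: "?good (S1 \<inter> S2) \<alpha>" if g: "?good S1 \<alpha>" "?good S2 \<alpha>" for S1 S2 \<alpha>
  proof -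
    obtain K1 U1 K2 U2 where
      1: "finite K1" "K1 \<subseteq> carrier M" "U1 \<in> entourages T" "CMA_entourage M T K1 U1 `` {\<alpha>} \<subseteq> S1"
      and 2: "finite K2" "K2 \<subseteq> carrier M" "U2 \<in> entourages T" "CMA_entourage M T K2 U2 `` {\<alpha>} \<subseteq> S2"
      using g by metis
    have "CMA_entourage M T (K1 \<union> K2) (U1 \<inter> U2) \<subseteq> CMA_entourage M T K1 U1 \<inter> CMA_entourage M T K2 U2"
      unfolding CMA_entourage_def by blast
    then have "CMA_entourage M T (K1 \<union> K2) (U1 \<inter> U2) `` {\<alpha>} \<subseteq> S1 \<inter> S2"
      using 1 2 by blast
    then show ?thesis
      using 1 2 entourages_Int[OF 1(3) 2(3)] by (metis finite_UnI Un_least)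
  qed
  have un: "?good (\<Union>\<K>) \<alpha>" if g: "?good S \<alpha>" and S: "S \<in> \<K>" for S \<K> \<alpha>
    using g S by (meson Union_upper subset_trans)
  have "istopology (\<lambda>S. S \<subseteq> CMA M T \<and> (\<forall>\<alpha>\<in>S. ?good S \<alpha>))"
    unfolding istopology_def
  proof (intro conjI allI impI ballI)
    fix S1 S2 :: "('m \<Rightarrow> 'x \<Rightarrow> 'x) set" and \<alpha>
    assume a: "S1 \<subseteq> CMA M T \<and> (\<forall>\<alpha>\<in>S1. ?good S1 \<alpha>)" "S2 \<subseteq> CMA M T \<and> (\<forall>\<alpha>\<in>S2. ?good S2 \<alpha>)"
    show "S1 \<inter> S2 \<subseteq> CMA M T" using a by blast
    assume "\<alpha> \<in> S1 \<inter> S2"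
    then show "?good (S1 \<inter> S2) \<alpha>" using a by (intro int) blast+
  next
    fix \<K> :: "('m \<Rightarrow> 'x \<Rightarrow> 'x) set set" and \<alpha>
    assume a: "\<forall>S\<in>\<K>. S \<subseteq> CMA M T \<and> (\<forall>\<alpha>\<in>S. ?good S \<alpha>)"
    show "\<Union>\<K> \<subseteq> CMA M T" using a by blast
    assume "\<alpha> \<in> \<Union>\<K>"
    then obtain S where "S \<in> \<K>" "\<alpha> \<in> S" by blast
    then show "?good (\<Union>\<K>) \<alpha>" using a by (intro un[where S=S]) blast+
  qed
  then show ?thesis
    unfolding CMA_topology_def by (simp add: topology_inverse')
qed

lemma topspace_CMA_topology: "topspace (CMA_topology M T) = CMA M T"
proof -
  have "openin (CMA_topology M T) (CMA M T)"
    unfolding openin_CMA_topology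
  proof (intro conjI ballI)
    fix \<alpha> assume "\<alpha> \<in> CMA M T"
    have "CMA_entourage M T {} (topspace T \<times> topspace T) `` {\<alpha>} \<subseteq> CMA M T"
      unfolding CMA_entourage_def by blast
    then show "\<exists>K U. finite K \<and> K \<subseteq> carrier M \<and> U \<in> entourages T \<and>
        CMA_entourage M T K U `` {\<alpha>} \<subseteq> CMA M T"
      using topspace_entourage by (metis finite.emptyI empty_subsetI)
  qed simp
  then show ?thesis
    by (metis openin_CMA_topology openin_subset openin_topspace subset_antisym)
qed

text \<open>Intended for compact Hausdorff \<open>T\<close> and \<open>\<alpha> \<in> CMA M T\<close>.\<close>

definition topologically_stable ::
    "('m, 'r) monoid_scheme \<Rightarrow> 'x topology \<Rightarrow> ('m \<Rightarrow> 'x \<Rightarrow> 'x) \<Rightarrow> bool" where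
  "topologically_stable M T \<alpha> \<longleftrightarrow>
     (\<forall>U\<in>entourages T. \<exists>N\<in>neighborhoods (CMA_topology M T) {\<alpha>}. \<forall>\<beta>\<in>N.
        \<exists>h. continuous_map T T h \<and>
            (\<forall>m\<in>carrier M. \<forall>x\<in>topspace T. \<alpha> m (h x) = h (\<beta> m x)) \<and>
            (\<forall>x\<in>topspace T. (h x, x) \<in> U))"

definition full_shift :: "('m, 'r) monoid_scheme \<Rightarrow> 'a set \<Rightarrow> ('m \<Rightarrow> 'a) topology" where
  "full_shift M A = product_topology (\<lambda>_. discrete_topology A) (carrier M)"

lemma topspace_full_shift: "topspace (full_shift M A) = carrier M \<rightarrow>\<^sub>E A"
  by (simp add: full_shift_def)

definition shift :: "('m, 'r) monoid_scheme \<Rightarrow> 'm \<Rightarrow> ('m \<Rightarrow> 'a) \<Rightarrow> 'm \<Rightarrow> 'a" where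
  "shift M m x = (\<lambda>m'\<in>carrier M. x (m' \<otimes>\<^bsub>M\<^esub> m))"

definition subshift :: "('m, 'r) monoid_scheme \<Rightarrow> 'a set \<Rightarrow> ('m \<Rightarrow> 'a) set \<Rightarrow> bool" where
  "subshift M A X \<longleftrightarrow> closedin (full_shift M A) X \<and> (\<forall>m\<in>carrier M. \<forall>x\<in>X. shift M m x \<in> X)"

definition subshift_of_finite_type ::
    "('m, 'r) monoid_scheme \<Rightarrow> 'a set \<Rightarrow> ('m \<Rightarrow> 'a) set \<Rightarrow> bool" where
  "subshift_of_finite_type M A X \<longleftrightarrow> subshift M A X \<and>
     (\<exists>W P. finite W \<and> W \<subseteq> carrier M \<and> P \<subseteq> W \<rightarrow>\<^sub>E A \<and>
        X = {x \<in> carrier M \<rightarrow>\<^sub>E A. \<forall>m\<in>carrier M. restrict (shift M m x) W \<in> P})"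

definition subshift_space ::
    "('m, 'r) monoid_scheme \<Rightarrow> 'a set \<Rightarrow> ('m \<Rightarrow> 'a) set \<Rightarrow> ('m \<Rightarrow> 'a) topology" where
  "subshift_space M A X = subtopology (full_shift M A) X"

definition shift_action ::
    "('m, 'r) monoid_scheme \<Rightarrow> ('m \<Rightarrow> 'a) set \<Rightarrow> 'm \<Rightarrow> ('m \<Rightarrow> 'a) \<Rightarrow> 'm \<Rightarrow> 'a" where
  "shift_action M X = (\<lambda>m\<in>carrier M. \<lambda>x\<in>X. shift M m x)"

lemma topspace_subshift_space:
  assumes "subshift M A X"
  shows "topspace (subshift_space M A X) = X"
  using assms closedin_subset unfolding subshift_def subshift_space_def by fastforce

lemma compact_Hausdorff_subshift_space:
  assumes "finite A" "subshift M A X"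
  shows "compact_space (subshift_space M A X)" "Hausdorff_space (subshift_space M A X)"
proof -
  have c: "compact_space (full_shift M A)"
    unfolding full_shift_def using assms(1)
    by (simp add: compact_space_product_topology compact_space_discrete_topology)
  show "compact_space (subshift_space M A X)"
    using closedin_compact_space[OF c] assms(2) unfolding subshift_def subshift_space_def
    by (simp add: compact_space_subtopology)
  show "Hausdorff_space (subshift_space M A X)"
    unfolding subshift_space_def full_shift_def
    by (simp add: Hausdorff_space_subtopology Hausdorff_space_product_topology
        Hausdorff_space_discrete_topology)
qed

lemma shift_action_in_CMA:
  assumes "monoid M" "subshift M A X"
  shows "shift_action M X \<in> CMA M (subshift_space M A X)"
proof -
  interpret monoid M by fact
  have top: "topspace (subshift_space M A X) = X"
    using assms(2) by (rule topspace_subshift_space)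
  have X: "X \<subseteq> carrier M \<rightarrow>\<^sub>E A"
    using assms(2) closedin_subset unfolding subshift_def by (metis topspace_full_shift)
  have inv: "shift M m x \<in> X" if "m \<in> carrier M" "x \<in> X" for m x
    using assms(2) that unfolding subshift_def by blast
  have cont: "continuous_map (subshift_space M A X) (subshift_space M A X) (shift_action M X m)"
    if m: "m \<in> carrier M" for m
  proof -
    have "continuous_map (subshift_space M A X) (full_shift M A) (shift M m)"
      unfolding full_shift_def continuous_map_componentwise
    proof (intro conjI ballI)
      show "shift M m ` topspace (subshift_space M A X) \<subseteq> extensional (carrier M)"
        by (auto simp: shift_def)
    next
      fix k assume k: "k \<in> carrier M"
      have "continuous_map (full_shift M A) (discrete_topology A) (\<lambda>x. x (k \<otimes>\<^bsub>M\<^esub> m))"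
        unfolding full_shift_def using k m by (intro continuous_map_product_projection) simp
      then show "continuous_map (subshift_space M A X) (discrete_topology A) (\<lambda>x. shift M m x k)"
        unfolding subshift_space_def using k
        by (simp add: shift_def continuous_map_from_subtopology)
    qed
    then have "continuous_map (subshift_space M A X) (subshift_space M A X) (shift M m)"
      unfolding subshift_space_def[of M A X]
      using inv[OF m] by (auto simp: continuous_map_in_subtopology)
    then show ?thesis
      by (rule continuous_map_eq) (simp add: top shift_action_def m)
  qed
  have "shift_action M X m (shift_action M X m' x) = shift_action M X (m \<otimes>\<^bsub>M\<^esub> m') x"
    if "m \<in> carrier M" "m' \<in> carrier M" "x \<in> X" for m m' x
    using that inv by (auto simp: shift_action_def shift_def m_assoc)
  moreover have "shift_action M X \<one>\<^bsub>M\<^esub> x = x" if "x \<in> X" for x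
    using that X by (auto simp: shift_action_def shift_def fun_eq_iff PiE_def extensional_def)
  moreover have "shift_action M X \<in> carrier M \<rightarrow>\<^sub>E (X \<rightarrow>\<^sub>E X)"
    using inv by (auto simp: shift_action_def)
  ultimately show ?thesis
    using cont unfolding CMA_def top by blast
qed

end

theory Submission
  imports Defs
begin

text \<open>Write \<open>\<alpha>\<close> for the shift action on \<open>X\<close> and let \<open>\<beta>\<close> be another continuous action of \<open>M\<close> on \<open>X\<close>.
  A point \<open>x\<close> of the shift is recovered from its \<open>\<alpha>\<close>-orbit by reading the letter at
  the identity: \<open>x m = (\<alpha> m x) \<one>\<close>. Reading the \<open>\<beta>\<close>-orbit in the same way gives a
  configuration \<open>h x = (\<lambda>m. (\<beta> m x) \<one>)\<close>, and the action law for \<open>\<beta>\<close> alone makes \<open>h\<close> intertwine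
  \<open>\<beta>\<close> with the shift.

  Closeness of \<open>\<beta>\<close> to \<open>\<alpha>\<close> is used twice, each time in the form that \<open>\<beta> k x\<close> and \<open>\<alpha> k x\<close> have the
  same letter at \<open>\<one>\<close> for all \<open>x\<close> and all \<open>k\<close> in a finite set \<open>K\<close>. If \<open>K\<close> contains the window \<open>W\<close>
  defining \<open>X\<close>, then the pattern of \<open>h x\<close> seen through \<open>W\<close> from position \<open>m\<close> is the pattern of the
  point \<open>\<beta> m x\<close> of \<open>X\<close> on \<open>W\<close>, hence allowed, and so \<open>h x \<in> X\<close>. This is where finite type enters:
  each condition for membership in \<open>X\<close> only concerns boundedly many steps of \<open>\<beta>\<close>, starting from a
  point of \<open>X\<close>. If \<open>K\<close> also contains a finite set \<open>F\<close> such that points of \<open>X\<close> that agree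
  on \<open>F\<close> are \<open>U\<close>-close, which exists by compactness (\<open>entourage_agree_on_finite\<close>), then \<open>h x\<close>
  agrees with \<open>x\<close> on \<open>F\<close>, and so \<open>(h x, x) \<in> U\<close>.\<close>

section \<open>Entourages of a subshift\<close>

lemma openin_full_shift_cylinder:
  assumes "x \<in> carrier M \<rightarrow>\<^sub>E A" and "finite F" and "F \<subseteq> carrier M"
  shows "openin (full_shift M A) {y \<in> carrier M \<rightarrow>\<^sub>E A. \<forall>i\<in>F. y i = x i}"
proof -
  let ?B = "\<lambda>i. if i \<in> F then {x i} else A"
  have "openin (full_shift M A) (PiE (carrier M) ?B)"
    unfolding full_shift_def
  proof (rule product_topology_basis)
    show "openin (discrete_topology A) (?B i)" for i
      using assms(1,3) by auto
    show "finite {i. ?B i \<noteq> topspace (discrete_topology A)}"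
      by (rule finite_subset[OF _ assms(2)]) auto
  qed
  moreover have "PiE (carrier M) ?B = {y \<in> carrier M \<rightarrow>\<^sub>E A. \<forall>i\<in>F. y i = x i}"
  proof (intro Set.set_eqI iffI)
    fix y assume y: "y \<in> PiE (carrier M) ?B"
    have "y i = x i" if "i \<in> F" for i
      using PiE_mem[OF y, of i] that assms(3) by auto
    moreover have "y i \<in> A" if "i \<in> carrier M" for i
      using PiE_mem[OF y that] PiE_mem[OF assms(1) that] by (auto split: if_splits)
    ultimately show "y \<in> {y \<in> carrier M \<rightarrow>\<^sub>E A. \<forall>i\<in>F. y i = x i}"
      using y by (simp add: PiE_iff)
  qed (simp add: PiE_iff)
  ultimately show ?thesis by simp
qed

lemma openin_full_shift_contains_cylinder:
  assumes "openin (full_shift M A) V" and "x \<in> V"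
  shows "\<exists>F. finite F \<and> F \<subseteq> carrier M \<and> (\<forall>y\<in>carrier M \<rightarrow>\<^sub>E A. (\<forall>i\<in>F. y i = x i) \<longrightarrow> y \<in> V)"
proof -
  obtain B where B: "finite {i \<in> carrier M. B i \<noteq> A}" "x \<in> PiE (carrier M) B"
    "PiE (carrier M) B \<subseteq> V"
    using assms unfolding full_shift_def openin_product_topology_alt by auto
  let ?F = "{i \<in> carrier M. B i \<noteq> A}"
  have "y \<in> V" if "y \<in> carrier M \<rightarrow>\<^sub>E A" "\<forall>i\<in>?F. y i = x i" for y
  proof -
    have "y i \<in> B i" if "i \<in> carrier M" for i
      using that \<open>y \<in> carrier M \<rightarrow>\<^sub>E A\<close> \<open>\<forall>i\<in>?F. y i = x i\<close> B(2) by (cases "B i = A") (auto simp: PiE_iff)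
    then have "y \<in> PiE (carrier M) B"
      using that(1) by (simp add: PiE_iff)
    then show ?thesis
      using B(3) by blast
  qed
  then show ?thesis
    using B(1) by (intro exI[of _ ?F]) auto
qed

text \<open>A Lebesgue number argument in which the radius is replaced by a finite set of coordinates:
  every point has a cylinder whose square lies in the entourage, finitely many of these cover \<open>X\<close>,
  and the coordinates of all of them are collected. Two points that agree there lie in a common
  cylinder of the cover.\<close>

lemma entourage_agree_on_finite:
  assumes "finite A" and X: "subshift M A X" and U: "U \<in> entourages (subshift_space M A X)"
  obtains F where "finite F" "F \<subseteq> carrier M"
    "\<And>x y. \<lbrakk>x \<in> X; y \<in> X; \<And>i. i \<in> F \<Longrightarrow> x i = y i\<rbrakk> \<Longrightarrow> (x, y) \<in> U"
proof -
  let ?T = "subshift_space M A X"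
  have top: "topspace ?T = X"
    using X by (rule topspace_subshift_space)
  have XA: "X \<subseteq> carrier M \<rightarrow>\<^sub>E A"
    using X closedin_subset unfolding subshift_def by (metis topspace_full_shift)
  obtain V where V: "openin (prod_topology ?T ?T) V" "Id_on X \<subseteq> V" "V \<subseteq> U"
    using U unfolding entourages_def neighborhoods_def top by blast
  have "\<exists>F. finite F \<and> F \<subseteq> carrier M \<and>
      (\<forall>y\<in>X. \<forall>z\<in>X. (\<forall>i\<in>F. y i = x i) \<longrightarrow> (\<forall>i\<in>F. z i = x i) \<longrightarrow> (y, z) \<in> V)"
    if x: "x \<in> X" for x
  proof -
    have "(x, x) \<in> V" using V(2) x by auto
    then obtain O1 O2 where O: "openin ?T O1" "openin ?T O2" "x \<in> O1" "x \<in> O2" "O1 \<times> O2 \<subseteq> V"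
      using V(1) unfolding openin_prod_topology_alt by meson
    have "openin ?T (O1 \<inter> O2)" using O by blast
    then obtain G where G: "openin (full_shift M A) G" "O1 \<inter> O2 = G \<inter> X"
      unfolding subshift_space_def openin_subtopology by blast
    then have "x \<in> G" using O by blast
    from openin_full_shift_contains_cylinder[OF G(1) this]
    obtain F where F: "finite F" "F \<subseteq> carrier M"
      "\<And>y. \<lbrakk>y \<in> carrier M \<rightarrow>\<^sub>E A; \<forall>i\<in>F. y i = x i\<rbrakk> \<Longrightarrow> y \<in> G" by blast
    have agree: "y \<in> O1 \<inter> O2" if "y \<in> X" "\<forall>i\<in>F. y i = x i" for y
      using F(3) G(2) XA that by blast
    have "(y, z) \<in> V"
      if "y \<in> X" "z \<in> X" "\<forall>i\<in>F. y i = x i" "\<forall>i\<in>F. z i = x i" for y z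
      using agree[of y] agree[of z] that subsetD[OF O(5), of "(y, z)"] by simp
    then show ?thesis
      using F(1,2) by (intro exI[of _ F]) simp
  qed
  then obtain \<Phi> where \<Phi>: "\<And>x. x \<in> X \<Longrightarrow> finite (\<Phi> x)" "\<And>x. x \<in> X \<Longrightarrow> \<Phi> x \<subseteq> carrier M"
    "\<And>x y z. \<lbrakk>x \<in> X; y \<in> X; z \<in> X; \<forall>i\<in>\<Phi> x. y i = x i; \<forall>i\<in>\<Phi> x. z i = x i\<rbrakk> \<Longrightarrow> (y, z) \<in> V"
    by metis
  define C where "C x = {y \<in> carrier M \<rightarrow>\<^sub>E A. \<forall>i\<in>\<Phi> x. y i = x i}" for x
  have "compactin (full_shift M A) X"
    using compact_Hausdorff_subshift_space(1)[OF assms(1) X] XA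
    unfolding subshift_space_def by (simp add: compact_space_subtopology compactin_subspace topspace_full_shift)
  moreover have "\<forall>D\<in>C ` X. openin (full_shift M A) D"
  proof
    fix D assume "D \<in> C ` X"
    then obtain x where "x \<in> X" "D = C x" by blast
    then show "openin (full_shift M A) D"
      unfolding C_def using XA \<Phi>(1,2) openin_full_shift_cylinder[of x M A "\<Phi> x"] by auto
  qed
  moreover have "X \<subseteq> \<Union>(C ` X)"
    unfolding C_def using XA by auto
  ultimately obtain \<D> where "finite \<D>" "\<D> \<subseteq> C ` X" "X \<subseteq> \<Union>\<D>"
    unfolding compactin_def by metis
  then obtain Y where Y: "finite Y" "Y \<subseteq> X" "X \<subseteq> \<Union>(C ` Y)"
    by (metis finite_subset_image)
  show ?thesis
  proof (rule that[of "\<Union>(\<Phi> ` Y)"])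
    show "finite (\<Union>(\<Phi> ` Y))"
      using Y(1,2) \<Phi>(1) by auto
    show "\<Union>(\<Phi> ` Y) \<subseteq> carrier M"
    proof (rule UN_least)
      fix c assume "c \<in> Y"
      then have "c \<in> X" using Y(2) by blast
      then show "\<Phi> c \<subseteq> carrier M" by (rule \<Phi>(2))
    qed
    fix x y assume xy: "x \<in> X" "y \<in> X" and eq: "\<And>i. i \<in> \<Union>(\<Phi> ` Y) \<Longrightarrow> x i = y i"
    obtain c where c: "c \<in> Y" "x \<in> C c" using Y(3) xy(1) by blast
    have "\<forall>i\<in>\<Phi> c. x i = c i" using c(2) by (simp add: C_def)
    moreover from this have "\<forall>i\<in>\<Phi> c. y i = c i" using eq c(1) by fastforce
    ultimately have "(x, y) \<in> V" using \<Phi>(3)[of c] c(1) Y(2) xy by blast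
    then show "(x, y) \<in> U" using V(3) by blast
  qed
qed

lemma agree_at_entourage:
  assumes X: "subshift M A X" and i: "i \<in> carrier M"
  shows "{(x, y) \<in> X \<times> X. x i = y i} \<in> entourages (subshift_space M A X)" (is "?D \<in> _")
proof -
  let ?T = "subshift_space M A X"
  have top: "topspace ?T = X"
    using X by (rule topspace_subshift_space)
  have eval: "continuous_map ?T (discrete_topology A) (\<lambda>x. x i)"
    unfolding subshift_space_def full_shift_def
    using i by (intro continuous_map_from_subtopology continuous_map_product_projection)
  have "openin (prod_topology ?T ?T) ?D"
    unfolding openin_prod_topology_alt
  proof (intro allI impI)
    fix x y assume xy: "(x, y) \<in> ?D"
    let ?C = "{z \<in> topspace ?T. z i \<in> {x i}}"
    have "x i \<in> A"
      using continuous_map_funspace[OF eval] xy top by auto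
    then have "openin ?T ?C"
      by (intro openin_continuous_map_preimage[OF eval]) simp
    then show "\<exists>S S'. openin ?T S \<and> openin ?T S' \<and> x \<in> S \<and> y \<in> S' \<and> S \<times> S' \<subseteq> ?D"
      using xy top by (intro exI[of _ ?C]) auto
  qed
  then show ?thesis
    unfolding entourages_def neighborhoods_def top by (auto simp: top)
qed

section \<open>Neighborhoods of an action\<close>

text \<open>In general the ball of an entourage around \<open>\<alpha>\<close> only contains an open set around \<open>\<alpha>\<close>.
  Transitivity replaces the triangle inequality without loss of radius, as in an ultrametric
  space, so that the ball itself is open.\<close>

lemma transitive_ball_neighborhood:
  assumes \<alpha>: "\<alpha> \<in> CMA M T" and K: "finite K" "K \<subseteq> carrier M"
    and U: "U \<in> entourages T" and "trans U"
  shows "CMA_entourage M T K U `` {\<alpha>} \<in> neighborhoods (CMA_topology M T) {\<alpha>}" (is "?N \<in> _")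
proof -
  have "Id_on (topspace T) \<subseteq> U"
    using U unfolding entourages_def neighborhoods_def by blast
  moreover have "\<alpha> k x \<in> topspace T" if "k \<in> K" "x \<in> topspace T" for k x
    using \<alpha> K that unfolding CMA_def by fastforce
  ultimately have "\<alpha> \<in> ?N"
    using \<alpha> unfolding CMA_entourage_def by blast
  moreover have N: "?N \<subseteq> CMA M T"
    unfolding CMA_entourage_def by blast
  moreover have "CMA_entourage M T K U `` {\<beta>} \<subseteq> ?N" if "\<beta> \<in> ?N" for \<beta>
    using that \<open>trans U\<close> unfolding CMA_entourage_def by (blast dest: transD)
  then have "openin (CMA_topology M T) ?N"
    unfolding openin_CMA_topology using K U N by blast
  ultimately show ?thesis
    unfolding neighborhoods_def topspace_CMA_topology by blast
qed

section \<open>Itineraries\<close>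

definition itinerary :: "('m, 'r) monoid_scheme \<Rightarrow> ('m \<Rightarrow> 'x \<Rightarrow> 'm \<Rightarrow> 'a) \<Rightarrow> 'x \<Rightarrow> 'm \<Rightarrow> 'a" where
  "itinerary M \<beta> x = (\<lambda>m\<in>carrier M. \<beta> m x \<one>\<^bsub>M\<^esub>)"

lemma shift_itinerary:
  assumes "monoid M" and "\<beta> \<in> CMA M T" and "m \<in> carrier M" and "x \<in> topspace T"
  shows "shift M m (itinerary M \<beta> x) = itinerary M \<beta> (\<beta> m x)"
proof -
  interpret monoid M by fact
  show ?thesis
    using assms(2-4) by (auto simp: shift_def itinerary_def CMA_def fun_eq_iff)
qed

lemma continuous_map_itinerary:
  assumes "monoid M" and "\<beta> \<in> CMA M (subshift_space M A X)"
  shows "continuous_map (subshift_space M A X) (full_shift M A) (itinerary M \<beta>)"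
  unfolding full_shift_def continuous_map_componentwise
proof (intro conjI ballI)
  interpret monoid M by fact
  show "itinerary M \<beta> ` topspace (subshift_space M A X) \<subseteq> extensional (carrier M)"
    by (auto simp: itinerary_def)
  fix m assume m: "m \<in> carrier M"
  have "continuous_map (subshift_space M A X) (discrete_topology A) (\<lambda>x. x \<one>\<^bsub>M\<^esub>)"
    unfolding subshift_space_def full_shift_def
    by (intro continuous_map_from_subtopology continuous_map_product_projection) simp
  moreover have "continuous_map (subshift_space M A X) (subshift_space M A X) (\<beta> m)"
    using assms(2) m by (simp add: CMA_def)
  ultimately have "continuous_map (subshift_space M A X) (discrete_topology A) (\<lambda>x. \<beta> m x \<one>\<^bsub>M\<^esub>)"
    using continuous_map_compose[of _ _ "\<beta> m" _ "\<lambda>x. x \<one>\<^bsub>M\<^esub>"] by (simp add: o_def)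
  then show "continuous_map (subshift_space M A X) (discrete_topology A) (\<lambda>x. itinerary M \<beta> x m)"
    using m by (simp add: itinerary_def)
qed

section \<open>Topological stability\<close>

theorem corollary1p3:
  fixes M :: "('m, 'r) monoid_scheme" and A :: "'a set" and X :: "('m \<Rightarrow> 'a) set"
  assumes "monoid M"
    and "finite A"
    and "subshift_of_finite_type M A X"
  shows "topologically_stable M (subshift_space M A X) (shift_action M X)"
  unfolding topologically_stable_def
proof
  interpret monoid M by fact
  let ?T = "subshift_space M A X" and ?\<alpha> = "shift_action M X"
  obtain W P where X: "subshift M A X" and W: "finite W" "W \<subseteq> carrier M"
    and XP: "X = {x \<in> carrier M \<rightarrow>\<^sub>E A. \<forall>m\<in>carrier M. restrict (shift M m x) W \<in> P}"
    using assms(3) unfolding subshift_of_finite_type_def by blast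
  have top: "topspace ?T = X"
    using X by (rule topspace_subshift_space)
  fix U assume U: "U \<in> entourages ?T"
  obtain F where F: "finite F" "F \<subseteq> carrier M"
    and close: "\<And>x y. \<lbrakk>x \<in> X; y \<in> X; \<And>i. i \<in> F \<Longrightarrow> x i = y i\<rbrakk> \<Longrightarrow> (x, y) \<in> U"
    using entourage_agree_on_finite[OF assms(2) X U] by blast
  define D where "D = {(x, y) \<in> X \<times> X. x \<one>\<^bsub>M\<^esub> = y \<one>\<^bsub>M\<^esub>}"
  let ?N = "CMA_entourage M ?T (W \<union> F) D `` {?\<alpha>}"
  have "D \<in> entourages ?T"
    unfolding D_def by (rule agree_at_entourage[OF X one_closed])
  moreover have "trans D"
    unfolding D_def trans_def by auto
  ultimately have N: "?N \<in> neighborhoods (CMA_topology M ?T) {?\<alpha>}"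
    using W F by (intro transitive_ball_neighborhood shift_action_in_CMA assms(1) X) auto
  have "\<exists>h. continuous_map ?T ?T h \<and>
      (\<forall>m\<in>carrier M. \<forall>x\<in>topspace ?T. ?\<alpha> m (h x) = h (\<beta> m x)) \<and>
      (\<forall>x\<in>topspace ?T. (h x, x) \<in> U)" if \<beta>N: "\<beta> \<in> ?N" for \<beta>
  proof -
    have \<beta>: "\<beta> \<in> CMA M ?T"
      using \<beta>N unfolding CMA_entourage_def by blast
    have \<beta>X: "\<beta> m x \<in> X" if "m \<in> carrier M" "x \<in> X" for m x
      using \<beta> that unfolding CMA_def top by fastforce
    let ?h = "itinerary M \<beta>"
    have read: "?h x k = x k" if "k \<in> W \<union> F" "x \<in> X" for k x
    proof -
      have k: "k \<in> carrier M" using that W F by blast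
      have "(?\<alpha> k x, \<beta> k x) \<in> D"
        using \<beta>N that unfolding CMA_entourage_def top by blast
      then show ?thesis
        using k that by (simp add: D_def shift_action_def shift_def itinerary_def)
    qed
    have cont: "continuous_map ?T (full_shift M A) ?h"
      by (rule continuous_map_itinerary[OF assms(1) \<beta>])
    have hX: "?h x \<in> X" if x: "x \<in> X" for x
    proof -
      have "?h x \<in> carrier M \<rightarrow>\<^sub>E A"
        using continuous_map_funspace[OF cont] x by (auto simp: top topspace_full_shift)
      moreover have "restrict (shift M m (?h x)) W \<in> P" if m: "m \<in> carrier M" for m
      proof -
        let ?y = "\<beta> m x"
        have y: "?y \<in> X" using \<beta>X m x .
        have "restrict (shift M m (?h x)) W = restrict (?h ?y) W"
          using shift_itinerary[OF assms(1) \<beta> m] x top by simp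
        also have "\<dots> = restrict ?y W"
          using read y by (auto simp: restrict_def)
        also have "\<dots> = restrict (shift M \<one>\<^bsub>M\<^esub> ?y) W"
          using W by (auto simp: shift_def restrict_def fun_eq_iff)
        also have "\<dots> \<in> P"
          using y XP by blast
        finally show ?thesis .
      qed
      ultimately show ?thesis
        using XP by blast
    qed
    have "continuous_map ?T ?T ?h"
      using cont hX top unfolding subshift_space_def[of M A X]
      by (auto simp: continuous_map_in_subtopology)
    moreover have "?\<alpha> m (?h x) = ?h (\<beta> m x)" if "m \<in> carrier M" "x \<in> X" for m x
      using shift_itinerary[OF assms(1) \<beta>] that hX top by (simp add: shift_action_def)
    moreover have "(?h x, x) \<in> U" if "x \<in> X" for x
      using that by (intro close hX read) auto
    ultimately show ?thesis
      unfolding top by (intro exI[of _ ?h]) simp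
  qed
  then show "\<exists>N\<in>neighborhoods (CMA_topology M ?T) {?\<alpha>}. \<forall>\<beta>\<in>N. \<exists>h. continuous_map ?T ?T h \<and>
      (\<forall>m\<in>carrier M. \<forall>x\<in>topspace ?T. ?\<alpha> m (h x) = h (\<beta> m x)) \<and> (\<forall>x\<in>topspace ?T. (h x, x) \<in> U)"
    by (intro bexI[OF _ N] ballI)
qed

end
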